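(* Let $\rho>1$ and let $z_1,\dots,z_n\in\{z\in\mathbb{C}:|z|\le\rho\}$. Then the following inequality holds: $$\prod_{j\ne k}\bigl|1-\overline{z_j}z_k\bigr|\le(\rho^{2n}-1)^n(\rho^2-1)^{-n}.$$ Equality is attained if and only if the $z_j$ are the vertices of a regular $n$-gon inscribed in the circle $\{z\in\mathbb{C}:|z|=\rho\}$.
   Context: Here $n$ is the number of complex points $z_1,\dots,z_n$, $\rho$ is a real number, $\overline{z}$ denotes the complex conjugate of $z$, and the product runs over all ordered pairs $(j,k)$ of indices in $\{1,\dots,n\}$ with $j\ne k$.
   Formalization: The "only if" part of the equality statement is claimed only for n ≥ 2: for n = 1 both sides equal 1 for every point of the disc, so equality does not force |z_1| = ρ. The inequality and the "if" part are stated for all n ≥ 1. *)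

theory Defs
  imports Complex_Main
begin

text \<open>
  The set \<open>S\<close> consists of the vertices of a regular \<open>n\<close>-gon inscribed in the circle with
  centre \<open>c\<close> and radius \<open>r\<close>. A regular 2-gon is a pair of antipodal points of the circle.
\<close>

definition regular_ngon_vertices :: "nat \<Rightarrow> complex \<Rightarrow> real \<Rightarrow> complex set \<Rightarrow> bool" where
  "regular_ngon_vertices n c r S \<longleftrightarrow>
     (\<exists>\<theta>::real. S = (\<lambda>k. c + of_real r * cis (\<theta> + 2 * pi * real k / real n)) ` {..<n})"

end

theory Submission
  imports Defs "HOL-Complex_Analysis.Conformal_Mappings"
    "HOL-Computational_Algebra.Fundamental_Theorem_Algebra" "HOL-Real_Asymp.Real_Asymp"
begin

text \<open>
  Two facts carry the inequality: the maximum principle moves all points to the circle of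
  radius \<open>\<rho>\<close>, and on that circle the regular polygon is universally optimal for the
  logarithmic interaction that the product describes.

  On the circle, write \<open>z j = \<rho> * w j\<close> with unimodular \<open>w j\<close>, and put \<open>r = \<rho>\<^sup>2\<close>. Then
  \<open>\<bar>1 - cnj (z j) * z k\<bar> = \<bar>r - u\<bar>\<close> with \<open>u = w j * cnj (w k)\<close>, and the claim compares
  \<open>\<Sum> ln \<bar>r - u\<bar>\<^sup>2\<close> over all pairs with its value at the \<open>n\<close>-th roots of unity. The difference
  of the two sums tends to 0 as \<open>r\<close> tends to infinity, and its derivative in \<open>r\<close> is
  \<open>(r\<^sup>2 - 1) / r\<close> times the difference of the energies \<open>\<Sum> 1 / \<bar>r - u\<bar>\<^sup>2\<close>. So it suffices that
  the roots of unity minimize this energy for every \<open>r > 1\<close> (\<open>energy_ge\<close>, \<open>energy_root_unity\<close>);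
  then the difference of the logarithmic sums increases to 0, hence is at most 0
  (\<open>log_energy_le\<close>).

  The energy bound is a linear programming argument with an explicit certificate. For
  unimodular \<open>u\<close> (\<open>fejer_weight_decomp\<close>),
  \<open>D / \<bar>r - u\<bar>\<^sup>2 = \<bar>1 + u + \<dots> + u ^ (n - 1)\<bar>\<^sup>2 / \<bar>r - u\<bar>\<^sup>2 + H u\<close>
  where \<open>D > 0\<close> depends on \<open>n\<close> and \<open>r\<close> only and \<open>H\<close> is a trigonometric polynomial of degree less
  than \<open>n\<close> with nonnegative coefficients. The first term is nonnegative and vanishes at the
  nontrivial \<open>n\<close>-th roots of unity. The sum of \<open>H\<close> over all pairs is a nonnegative combination
  of squared moduli of power sums of the \<open>w j\<close>, hence is at least its constant part, and it
  equals that part for the roots of unity, whose power sums of orders \<open>1, \<dots>, n - 1\<close> vanish.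
  Equality forces \<open>1 + u + \<dots> + u ^ (n - 1) = 0\<close> for all pairs of distinct indices, so all
  quotients of the \<open>w j\<close> are nontrivial \<open>n\<close>-th roots of unity and the points form a regular
  polygon.

  Inside the disc, the product is, as a function of one point, a constant times the squared
  modulus of a polynomial, so moving an interior point to a suitable point of the circle strictly
  increases the product, unless the product is 0 or all other points are 0. In these two cases the product is 0 or
  1, which is below the bound for \<open>n \<ge> 2\<close> (\<open>offdiag_prod_le\<close>).
\<close>

section \<open>A kernel identity on the unit circle\<close>

lemma mult_cnj_of_norm_1: "norm u = 1 \<Longrightarrow> u * cnj u = 1"
  by (simp add: complex_norm_square [symmetric])

lemma norm_diff_of_real_sq:
  fixes u :: complex
  assumes "norm u = 1"
  shows "(cmod (of_real r - u))\<^sup>2 = r\<^sup>2 + 1 - 2 * r * Re u"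
proof -
  have "(Re u)\<^sup>2 + (Im u)\<^sup>2 = 1"
    using assms by (simp add: cmod_def)
  then show ?thesis
    by (simp add: cmod_power2 power2_diff algebra_simps)
qed

text \<open>
  The Fejer kernel: the squared modulus of the geometric sum in its Fourier form.
\<close>

lemma norm_geometric_sum_sq:
  fixes u :: complex
  assumes u: "norm u = 1"
  shows "(cmod (\<Sum>i<n. u ^ i))\<^sup>2 = real n + 2 * (\<Sum>m=1..<n. real (n - m) * Re (u ^ m))"
proof (induction n)
  case 0
  then show ?case by simp
next
  case (Suc n)
  have shift: "u ^ i * cnj (u ^ n) = cnj (u ^ (n - i))" if "i < n" for i
  proof -
    have "u ^ i * cnj (u ^ n) = u ^ i * (cnj u ^ i * cnj u ^ (n - i))"
      using that by (simp add: power_add [symmetric])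
    also have "\<dots> = (u * cnj u) ^ i * cnj u ^ (n - i)"
      by (simp add: power_mult_distrib)
    finally show ?thesis
      using mult_cnj_of_norm_1 [OF u] by simp
  qed
  have "Re ((\<Sum>i<n. u ^ i) * cnj (u ^ n)) = (\<Sum>i<n. Re (u ^ (n - i)))"
    unfolding sum_distrib_right Re_sum
    by (intro sum.cong refl) (simp add: shift del: complex_cnj_power)
  also have "\<dots> = (\<Sum>m=1..n. Re (u ^ m))"
    by (rule sum.reindex_bij_witness [of _ "\<lambda>m. n - m" "\<lambda>i. n - i"]) auto
  finally have cross: "Re ((\<Sum>i<n. u ^ i) * cnj (u ^ n)) = (\<Sum>m=1..n. Re (u ^ m))" .
  have "(cmod (\<Sum>i<Suc n. u ^ i))\<^sup>2
      = (cmod (\<Sum>i<n. u ^ i))\<^sup>2 + 1 + 2 * Re ((\<Sum>i<n. u ^ i) * cnj (u ^ n))"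
  proof -
    have "(cmod (x + y))\<^sup>2 = (cmod x)\<^sup>2 + (cmod y)\<^sup>2 + 2 * Re (x * cnj y)" for x y
      by (simp add: cmod_power2 power2_sum algebra_simps)
    from this [of "\<Sum>i<n. u ^ i" "u ^ n"] show ?thesis
      using u by (simp add: norm_power del: complex_cnj_power)
  qed
  also have "\<dots> = real (Suc n) + 2 * ((\<Sum>m=1..<n. real (n - m) * Re (u ^ m)) + (\<Sum>m=1..n. Re (u ^ m)))"
    unfolding Suc cross by simp
  also have "(\<Sum>m=1..<n. real (n - m) * Re (u ^ m)) = (\<Sum>m=1..n. real (n - m) * Re (u ^ m))"
    by (rule sum.mono_neutral_left) auto
  also have "\<dots> + (\<Sum>m=1..n. Re (u ^ m)) = (\<Sum>m=1..<Suc n. real (Suc n - m) * Re (u ^ m))"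
    unfolding sum.distrib [symmetric] atLeastLessThanSuc_atLeastAtMost
    by (rule sum.cong) (auto simp: Suc_diff_le algebra_simps)
  finally show ?case .
qed

text \<open>
  The Fourier form of the Fejer kernel, evaluated at the real point \<open>r\<close> instead of on the unit
  circle (\<open>2 * Re (u ^ m) = u ^ m + 1 / u ^ m\<close> becomes \<open>r ^ m + 1 / r ^ m\<close>).
\<close>

definition fejer_weight :: "nat \<Rightarrow> real \<Rightarrow> real" where
  "fejer_weight n r = real n + (\<Sum>m=1..<n. real (n - m) * (r ^ m + 1 / r ^ m))"

text \<open>
  The quotient of the difference of the Fejer kernel at \<open>r\<close> and at \<open>u\<close> by \<open>\<bar>r - u\<bar>\<^sup>2\<close>, for
  unimodular \<open>u\<close>. It is a positive combination of squared moduli of polynomials in \<open>u\<close> with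
  nonnegative coefficients, which makes its sums over pairs easy to bound from below.
\<close>

definition pos_kernel :: "nat \<Rightarrow> real \<Rightarrow> complex \<Rightarrow> real" where
  "pos_kernel n r u =
     (\<Sum>m=1..<n. real (n - m) / r ^ m * (cmod (\<Sum>i<m. of_real (r ^ (m - Suc i)) * u ^ i))\<^sup>2)"

lemma fejer_weight_pos: "n > 0 \<Longrightarrow> r > 0 \<Longrightarrow> fejer_weight n r > 0"
  unfolding fejer_weight_def by (intro add_pos_nonneg sum_nonneg) auto

text \<open>
  The termwise reason is that \<open>r ^ m + 1 / r ^ m - 2 * Re (u ^ m) = \<bar>r ^ m - u ^ m\<bar>\<^sup>2 / r ^ m\<close>,
  and \<open>r ^ m - u ^ m\<close> is divisible by \<open>r - u\<close>.
\<close>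

lemma fejer_weight_decomp:
  fixes u :: complex
  assumes u: "norm u = 1" and r: "r > 0"
  shows "fejer_weight n r
    = (cmod (\<Sum>i<n. u ^ i))\<^sup>2 + (cmod (of_real r - u))\<^sup>2 * pos_kernel n r u"
proof -
  have term_eq: "r ^ m + 1 / r ^ m - 2 * Re (u ^ m) = (cmod (of_real r - u))\<^sup>2 *
      ((cmod (\<Sum>i<m. of_real (r ^ (m - Suc i)) * u ^ i))\<^sup>2 / r ^ m)" for m
  proof -
    have "of_real (r ^ m) - u ^ m
        = (of_real r - u) * (\<Sum>i<m. of_real (r ^ (m - Suc i)) * u ^ i)"
      using power_diff_sumr2 [of u m "of_real r"] by (simp add: algebra_simps)
    then have "(cmod (of_real r - u))\<^sup>2 * (cmod (\<Sum>i<m. of_real (r ^ (m - Suc i)) * u ^ i))\<^sup>2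
        = (cmod (of_real (r ^ m) - u ^ m))\<^sup>2"
      by (simp add: norm_mult power_mult_distrib)
    also have "\<dots> = (r ^ m)\<^sup>2 + 1 - 2 * r ^ m * Re (u ^ m)"
      using u by (subst norm_diff_of_real_sq) (auto simp: norm_power)
    finally show ?thesis
      using r by (simp add: field_simps power2_eq_square)
  qed
  have "fejer_weight n r - (cmod (\<Sum>i<n. u ^ i))\<^sup>2
      = (\<Sum>m=1..<n. real (n - m) * (r ^ m + 1 / r ^ m - 2 * Re (u ^ m)))"
    unfolding fejer_weight_def norm_geometric_sum_sq [OF u]
    by (simp add: sum_distrib_left sum_subtractf [symmetric] right_diff_distrib mult.left_commute)
  also have "\<dots> = (cmod (of_real r - u))\<^sup>2 * pos_kernel n r u"
    unfolding term_eq pos_kernel_def by (simp add: sum_distrib_left mult_ac)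
  finally show ?thesis by simp
qed

lemma norm_diff_of_real_pos:
  fixes u :: complex
  assumes "norm u = 1" "r > 1"
  shows "cmod (of_real r - u) > 0"
  using assms by auto

section \<open>Pair sums of the positive kernel\<close>

text \<open>
  Summed over all pairs, the squared modulus of a polynomial in \<open>w j * cnj (w k)\<close> becomes a
  combination of squared moduli of moments. For unimodular \<open>w\<close> the moment with exponents \<open>i, l\<close>
  is the power sum of order \<open>i - l\<close>; the two separate exponents avoid negative powers.
\<close>

lemma pair_sum_norm_sq:
  fixes w :: "'a \<Rightarrow> complex" and c :: "nat \<Rightarrow> real"
  shows "(\<Sum>j\<in>A. \<Sum>k\<in>A. (cmod (\<Sum>i<m. of_real (c i) * (w j * cnj (w k)) ^ i))\<^sup>2)
    = (\<Sum>i<m. \<Sum>l<m. c i * c l * (cmod (\<Sum>j\<in>A. w j ^ i * cnj (w j) ^ l))\<^sup>2)"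
proof -
  have "complex_of_real (\<Sum>j\<in>A. \<Sum>k\<in>A. (cmod (\<Sum>i<m. of_real (c i) * (w j * cnj (w k)) ^ i))\<^sup>2)
      = (\<Sum>j\<in>A. \<Sum>k\<in>A. \<Sum>i<m. \<Sum>l<m. of_real (c i) * of_real (c l) *
          ((w j ^ i * cnj (w j) ^ l) * cnj (w k ^ i * cnj (w k) ^ l)))"
    unfolding of_real_sum complex_norm_square cnj_sum sum_product
    by (intro sum.cong refl) (simp add: power_mult_distrib mult_ac)
  also have "\<dots> = (\<Sum>j\<in>A. \<Sum>i<m. \<Sum>k\<in>A. \<Sum>l<m. of_real (c i) * of_real (c l) *
          ((w j ^ i * cnj (w j) ^ l) * cnj (w k ^ i * cnj (w k) ^ l)))"
    by (intro sum.cong refl sum.swap)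
  also have "\<dots> = (\<Sum>i<m. \<Sum>j\<in>A. \<Sum>k\<in>A. \<Sum>l<m. of_real (c i) * of_real (c l) *
          ((w j ^ i * cnj (w j) ^ l) * cnj (w k ^ i * cnj (w k) ^ l)))"
    by (rule sum.swap)
  also have "\<dots> = (\<Sum>i<m. \<Sum>j\<in>A. \<Sum>l<m. \<Sum>k\<in>A. of_real (c i) * of_real (c l) *
          ((w j ^ i * cnj (w j) ^ l) * cnj (w k ^ i * cnj (w k) ^ l)))"
    by (intro sum.cong refl sum.swap)
  also have "\<dots> = (\<Sum>i<m. \<Sum>l<m. \<Sum>j\<in>A. \<Sum>k\<in>A. of_real (c i) * of_real (c l) *
          ((w j ^ i * cnj (w j) ^ l) * cnj (w k ^ i * cnj (w k) ^ l)))"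
    by (intro sum.cong refl sum.swap)
  also have "\<dots> = (\<Sum>i<m. \<Sum>l<m. of_real (c i) * of_real (c l) *
      ((\<Sum>j\<in>A. w j ^ i * cnj (w j) ^ l) * cnj (\<Sum>j\<in>A. w j ^ i * cnj (w j) ^ l)))"
    unfolding cnj_sum sum_product by (simp only: sum_distrib_left)
  also have "\<dots> = complex_of_real
      (\<Sum>i<m. \<Sum>l<m. c i * c l * (cmod (\<Sum>j\<in>A. w j ^ i * cnj (w j) ^ l))\<^sup>2)"
    unfolding of_real_sum of_real_mult complex_norm_square ..
  finally show ?thesis
    by (simp only: of_real_eq_iff)
qed

text \<open>
  The part of the pair sum of \<^const>\<open>pos_kernel\<close> that is the same for all configurations
  of \<open>n\<close> unimodular points: the terms of equal exponents.
\<close>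

definition pos_kernel_min :: "nat \<Rightarrow> real \<Rightarrow> real" where
  "pos_kernel_min n r =
     (\<Sum>m=1..<n. real (n - m) / r ^ m * (\<Sum>i<m. (r ^ (m - Suc i))\<^sup>2 * (real n)\<^sup>2))"

lemma moment_diag:
  fixes w :: "'a \<Rightarrow> complex"
  assumes "\<And>j. j \<in> A \<Longrightarrow> norm (w j) = 1"
  shows "(\<Sum>j\<in>A. w j ^ i * cnj (w j) ^ i) = of_nat (card A)"
proof -
  have "(\<Sum>j\<in>A. w j ^ i * cnj (w j) ^ i) = (\<Sum>j\<in>A. 1)"
    using assms by (intro sum.cong refl) (simp add: power_mult_distrib [symmetric] mult_cnj_of_norm_1)
  then show ?thesis by simp
qed

lemma pos_kernel_pair_sum:
  fixes w :: "'a \<Rightarrow> complex"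
  shows "(\<Sum>j\<in>A. \<Sum>k\<in>A. pos_kernel n r (w j * cnj (w k))) =
    (\<Sum>m=1..<n. real (n - m) / r ^ m * (\<Sum>i<m. \<Sum>l<m.
        r ^ (m - Suc i) * r ^ (m - Suc l) * (cmod (\<Sum>j\<in>A. w j ^ i * cnj (w j) ^ l))\<^sup>2))"
proof -
  have "(\<Sum>j\<in>A. \<Sum>k\<in>A. pos_kernel n r (w j * cnj (w k))) =
    (\<Sum>j\<in>A. \<Sum>m=1..<n. \<Sum>k\<in>A. real (n - m) / r ^ m *
       (cmod (\<Sum>i<m. of_real (r ^ (m - Suc i)) * (w j * cnj (w k)) ^ i))\<^sup>2)"
    unfolding pos_kernel_def by (intro sum.cong refl sum.swap)
  also have "\<dots> = (\<Sum>m=1..<n. \<Sum>j\<in>A. \<Sum>k\<in>A. real (n - m) / r ^ m *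
       (cmod (\<Sum>i<m. of_real (r ^ (m - Suc i)) * (w j * cnj (w k)) ^ i))\<^sup>2)"
    by (rule sum.swap)
  also have "\<dots> = (\<Sum>m=1..<n. real (n - m) / r ^ m * (\<Sum>j\<in>A. \<Sum>k\<in>A.
       (cmod (\<Sum>i<m. of_real (r ^ (m - Suc i)) * (w j * cnj (w k)) ^ i))\<^sup>2))"
    by (simp only: sum_distrib_left)
  finally show ?thesis
    unfolding pair_sum_norm_sq .
qed

lemma pos_kernel_pair_sum_ge:
  fixes w :: "'a \<Rightarrow> complex"
  assumes w: "\<And>j. j \<in> A \<Longrightarrow> norm (w j) = 1" and n: "card A = n" and r: "r > 0"
  shows "(\<Sum>j\<in>A. \<Sum>k\<in>A. pos_kernel n r (w j * cnj (w k))) \<ge> pos_kernel_min n r"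
  unfolding pos_kernel_pair_sum pos_kernel_min_def
proof (intro sum_mono mult_left_mono)
  fix m i :: nat assume "i \<in> {..<m}"
  have "(r ^ (m - Suc i))\<^sup>2 * (real n)\<^sup>2
      = r ^ (m - Suc i) * r ^ (m - Suc i) * (cmod (\<Sum>j\<in>A. w j ^ i * cnj (w j) ^ i))\<^sup>2"
    using moment_diag [of A w i, OF w] n by (simp add: power2_eq_square)
  also have "\<dots> \<le> (\<Sum>l<m. r ^ (m - Suc i) * r ^ (m - Suc l)
      * (cmod (\<Sum>j\<in>A. w j ^ i * cnj (w j) ^ l))\<^sup>2)"
    using \<open>i \<in> {..<m}\<close> r by (intro member_le_sum) auto
  finally show "(r ^ (m - Suc i))\<^sup>2 * (real n)\<^sup>2 \<le> \<dots>" .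
qed (use r in auto)

lemma pos_kernel_pair_sum_eq:
  fixes w :: "'a \<Rightarrow> complex"
  assumes w: "\<And>j. j \<in> A \<Longrightarrow> norm (w j) = 1" and n: "card A = n"
    and moments: "\<And>i l. i < n \<Longrightarrow> l < n \<Longrightarrow> i \<noteq> l \<Longrightarrow> (\<Sum>j\<in>A. w j ^ i * cnj (w j) ^ l) = 0"
  shows "(\<Sum>j\<in>A. \<Sum>k\<in>A. pos_kernel n r (w j * cnj (w k))) = pos_kernel_min n r"
  unfolding pos_kernel_pair_sum pos_kernel_min_def
proof (intro sum.cong refl arg_cong2 [of _ _ _ _ "(*)"])
  fix m i :: nat assume m: "m \<in> {1..<n}" and i: "i \<in> {..<m}"
  have "(\<Sum>l<m. r ^ (m - Suc i) * r ^ (m - Suc l)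
      * (cmod (\<Sum>j\<in>A. w j ^ i * cnj (w j) ^ l))\<^sup>2) =
    (\<Sum>l\<in>{i}. r ^ (m - Suc i) * r ^ (m - Suc l)
      * (cmod (\<Sum>j\<in>A. w j ^ i * cnj (w j) ^ l))\<^sup>2)"
    using m i moments by (intro sum.mono_neutral_right) auto
  also have "\<dots> = (r ^ (m - Suc i))\<^sup>2 * (real n)\<^sup>2"
    using moment_diag [of A w i, OF w] n by (simp add: power2_eq_square)
  finally show "(\<Sum>l<m. r ^ (m - Suc i) * r ^ (m - Suc l)
      * (cmod (\<Sum>j\<in>A. w j ^ i * cnj (w j) ^ l))\<^sup>2) = (r ^ (m - Suc i))\<^sup>2 * (real n)\<^sup>2" .
qed

section \<open>Minimal energy\<close>

text \<open>
  The energy of a configuration; the diagonal pairs are included, since they contribute the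
  same to every unimodular configuration.
\<close>

definition energy :: "'a set \<Rightarrow> ('a \<Rightarrow> complex) \<Rightarrow> real \<Rightarrow> real" where
  "energy A w r = (\<Sum>j\<in>A. \<Sum>k\<in>A. 1 / (cmod (of_real r - w j * cnj (w k)))\<^sup>2)"

text \<open>
  The energy of the \<open>n\<close>-th roots of unity, in the form that the kernel identity gives it.
  The first summand comes from the \<open>n\<close> diagonal pairs.
\<close>

definition energy_min :: "nat \<Rightarrow> real \<Rightarrow> real" where
  "energy_min n r = (real n * ((real n)\<^sup>2 / (r - 1)\<^sup>2) + pos_kernel_min n r) / fejer_weight n r"

text \<open>
  The off-diagonal part of the first term in the kernel identity. For \<open>r > 1\<close> and unimodular \<open>w\<close> it
  vanishes exactly when the geometric sums of all pairs of distinct indices do.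
\<close>

definition fejer_energy :: "'a set \<Rightarrow> ('a \<Rightarrow> complex) \<Rightarrow> real \<Rightarrow> real" where
  "fejer_energy A w r = (\<Sum>j\<in>A. \<Sum>k\<in>A - {j}.
     (cmod (\<Sum>i<card A. (w j * cnj (w k)) ^ i))\<^sup>2 / (cmod (of_real r - w j * cnj (w k)))\<^sup>2)"

lemma energy_decomp:
  fixes w :: "'a \<Rightarrow> complex"
  assumes "finite A" and w: "\<And>j. j \<in> A \<Longrightarrow> norm (w j) = 1" and n: "card A = n" and r: "r > 1"
  shows "fejer_weight n r * energy A w r = real n * ((real n)\<^sup>2 / (r - 1)\<^sup>2)
    + fejer_energy A w r + (\<Sum>j\<in>A. \<Sum>k\<in>A. pos_kernel n r (w j * cnj (w k)))"
proof -
  let ?f = "\<lambda>u. (cmod (\<Sum>i<n. u ^ i))\<^sup>2 / (cmod (of_real r - u))\<^sup>2"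
  have nu: "norm (w j * cnj (w k)) = 1" if "j \<in> A" "k \<in> A" for j k
    using w that by (simp add: norm_mult)
  have "fejer_weight n r * (1 / (cmod (of_real r - u))\<^sup>2) = ?f u + pos_kernel n r u"
    if "norm u = 1" for u
    using fejer_weight_decomp [OF that, of r n] norm_diff_of_real_pos [OF that r] r
    by (simp add: field_simps)
  then have "fejer_weight n r * energy A w r
      = (\<Sum>j\<in>A. \<Sum>k\<in>A. ?f (w j * cnj (w k)) + pos_kernel n r (w j * cnj (w k)))"
    unfolding energy_def sum_distrib_left using nu by (intro sum.cong refl) blast
  moreover have "(\<Sum>j\<in>A. \<Sum>k\<in>A. ?f (w j * cnj (w k)))
      = real n * ((real n)\<^sup>2 / (r - 1)\<^sup>2) + fejer_energy A w r"
  proof -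
    have "(\<Sum>k\<in>A. ?f (w j * cnj (w k)))
        = (real n)\<^sup>2 / (r - 1)\<^sup>2 + (\<Sum>k\<in>A - {j}. ?f (w j * cnj (w k)))" if "j \<in> A" for j
    proof -
      have "w j * cnj (w j) = 1"
        using w that by (simp add: mult_cnj_of_norm_1)
      moreover have "cmod (of_real r - 1) = \<bar>r - 1\<bar>"
        by (metis norm_of_real of_real_1 of_real_diff)
      ultimately have "?f (w j * cnj (w j)) = (real n)\<^sup>2 / (r - 1)\<^sup>2"
        by simp
      then show ?thesis
        using \<open>finite A\<close> that by (simp add: sum.remove)
    qed
    then show ?thesis
      unfolding fejer_energy_def by (simp add: sum.distrib n)
  qed
  ultimately show ?thesis
    by (simp add: sum.distrib)
qed

lemma energy_ge:
  fixes w :: "'a \<Rightarrow> complex"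
  assumes "finite A" and w: "\<And>j. j \<in> A \<Longrightarrow> norm (w j) = 1" and n: "card A = n" "n > 0" and r: "r > 1"
  shows "energy A w r \<ge> energy_min n r + fejer_energy A w r / fejer_weight n r"
proof -
  have "fejer_weight n r > 0"
    using n r by (intro fejer_weight_pos) auto
  moreover have "(\<Sum>j\<in>A. \<Sum>k\<in>A. pos_kernel n r (w j * cnj (w k))) \<ge> pos_kernel_min n r"
    using assms by (intro pos_kernel_pair_sum_ge) auto
  ultimately show ?thesis
    using energy_decomp [of A w n r] assms
    by (simp add: energy_min_def add_divide_distrib [symmetric] divide_le_eq mult.commute)
qed

text \<open>
  The \<open>k\<close>-th of the \<open>n\<close>-th roots of unity.
\<close>

definition root_unity :: "nat \<Rightarrow> nat \<Rightarrow> complex" where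
  "root_unity n k = cis (2 * pi * real k / real n)"

lemma norm_root_unity [simp]: "norm (root_unity n k) = 1"
  by (simp add: root_unity_def)

lemma bij_betw_root_unity: "n > 0 \<Longrightarrow> bij_betw (root_unity n) {..<n} {z. z ^ n = 1}"
  using Complex.bij_betw_roots_unity unfolding root_unity_def [abs_def] .

lemma root_unity_power_swap: "root_unity n j ^ i = root_unity n i ^ j"
  unfolding root_unity_def Complex.DeMoivre by (simp add: mult_ac)

lemma geometric_sum_root_unity:
  assumes "n > 0" "j < n" "k < n" "j \<noteq> k"
  shows "(\<Sum>i<n. (root_unity n j * cnj (root_unity n k)) ^ i) = 0"
proof -
  have one: "root_unity n j ^ n = 1" "root_unity n k ^ n = 1"
    using bij_betw_root_unity [OF assms(1)] assms by (auto simp: bij_betw_def)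
  have "root_unity n j \<noteq> root_unity n k"
    using bij_betw_root_unity [OF assms(1)] assms by (auto simp: bij_betw_def inj_on_def)
  moreover have "root_unity n j * cnj (root_unity n k) = 1 \<Longrightarrow> root_unity n j = root_unity n k"
    using mult_cnj_of_norm_1 [of "root_unity n k"] by (metis mult.commute mult.left_commute mult_1_right norm_root_unity)
  ultimately have "root_unity n j * cnj (root_unity n k) \<noteq> 1"
    by blast
  moreover have "(root_unity n j * cnj (root_unity n k)) ^ n = 1"
    using one by (simp add: power_mult_distrib flip: complex_cnj_power)
  ultimately show ?thesis
    by (simp add: geometric_sum)
qed

lemma energy_root_unity:
  assumes n: "n > 0" and r: "r > 1"
  shows "energy {..<n} (root_unity n) r = energy_min n r"
proof -
  have "fejer_weight n r > 0"
    using n r by (intro fejer_weight_pos) auto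
  moreover have "(\<Sum>j<n. \<Sum>k<n. pos_kernel n r (root_unity n j * cnj (root_unity n k))) = pos_kernel_min n r"
  proof (rule pos_kernel_pair_sum_eq)
    fix i l assume il: "i < n" "l < n" "i \<noteq> l"
    have "(\<Sum>j<n. root_unity n j ^ i * cnj (root_unity n j) ^ l)
        = (\<Sum>j<n. (root_unity n i * cnj (root_unity n l)) ^ j)"
      by (simp add: power_mult_distrib root_unity_power_swap flip: complex_cnj_power)
    then show "(\<Sum>j<n. root_unity n j ^ i * cnj (root_unity n j) ^ l) = 0"
      using il n geometric_sum_root_unity by simp
  qed auto
  moreover have "fejer_energy {..<n} (root_unity n) r = 0"
    unfolding fejer_energy_def using n geometric_sum_root_unity by (auto intro!: sum.neutral)
  ultimately show ?thesis
    using energy_decomp [of "{..<n}" "root_unity n" n r] n r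
    by (simp add: energy_min_def field_simps)
qed


section \<open>The extremal problem on the circle\<close>

text \<open>
  The logarithm of the squared product over all pairs, the diagonal included.
\<close>

definition log_energy :: "'a set \<Rightarrow> ('a \<Rightarrow> complex) \<Rightarrow> real \<Rightarrow> real" where
  "log_energy A w r = (\<Sum>j\<in>A. \<Sum>k\<in>A. ln ((cmod (of_real r - w j * cnj (w k)))\<^sup>2))"

text \<open>
  The derivative is affine in \<open>1 / \<bar>r - u\<bar>\<^sup>2\<close> with coefficients independent of \<open>u\<close>; this links
  the logarithmic sum to the energy.
\<close>

lemma DERIV_ln_norm_diff_sq:
  fixes u :: complex
  assumes u: "norm u = 1" and r: "r > 1"
  shows "((\<lambda>r. ln ((cmod (of_real r - u))\<^sup>2)) has_real_derivative
    1 / r + (r\<^sup>2 - 1) / r * (1 / (cmod (of_real r - u))\<^sup>2)) (at r)"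
proof -
  define q where "q = r\<^sup>2 + 1 - 2 * r * Re u"
  have q: "q = (cmod (of_real r - u))\<^sup>2"
    unfolding q_def using norm_diff_of_real_sq [OF u] by simp
  then have "q > 0"
    using norm_diff_of_real_pos [OF u r] by simp
  have "((\<lambda>r. ln (r\<^sup>2 + 1 - 2 * r * Re u)) has_real_derivative (2 * r - 2 * Re u) / q) (at r)"
    using \<open>q > 0\<close> unfolding q_def by (auto intro!: derivative_eq_intros)
  moreover have "(2 * r - 2 * Re u) / q = 1 / r + (r\<^sup>2 - 1) / r * (1 / q)"
  proof -
    have "r * (2 * r - 2 * Re u) = q + (r\<^sup>2 - 1)"
      unfolding q_def by (simp add: algebra_simps power2_eq_square)
    then have *: "2 * r - 2 * Re u = (q + (r\<^sup>2 - 1)) / r"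
      using r by (simp add: nonzero_eq_divide_eq mult.commute)
    show ?thesis
      unfolding * using \<open>q > 0\<close> r by (simp add: add_divide_distrib)
  qed
  ultimately show ?thesis
    unfolding norm_diff_of_real_sq [OF u] q_def by simp
qed

lemma DERIV_log_energy:
  fixes w :: "'a \<Rightarrow> complex"
  assumes w: "\<And>j. j \<in> A \<Longrightarrow> norm (w j) = 1" and r: "r > 1"
  shows "(log_energy A w has_real_derivative
    (real (card A))\<^sup>2 / r + (r\<^sup>2 - 1) / r * energy A w r) (at r)"
proof -
  have "(log_energy A w has_real_derivative (\<Sum>j\<in>A. \<Sum>k\<in>A.
      1 / r + (r\<^sup>2 - 1) / r * (1 / (cmod (of_real r - w j * cnj (w k)))\<^sup>2))) (at r)"
    unfolding log_energy_def [abs_def] using w r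
    by (intro DERIV_sum DERIV_ln_norm_diff_sq) (auto simp: norm_mult)
  also have "(\<Sum>j\<in>A. \<Sum>k\<in>A. 1 / r + (r\<^sup>2 - 1) / r * (1 / (cmod (of_real r - w j * cnj (w k)))\<^sup>2))
      = (real (card A))\<^sup>2 / r + (r\<^sup>2 - 1) / r * energy A w r"
    unfolding energy_def sum_distrib_left sum.distrib by (simp add: power2_eq_square)
  finally show ?thesis .
qed

lemma log_energy_tendsto:
  fixes w :: "'a \<Rightarrow> complex"
  assumes w: "\<And>j. j \<in> A \<Longrightarrow> norm (w j) = 1"
  shows "((\<lambda>r. log_energy A w r - 2 * (real (card A))\<^sup>2 * ln r) \<longlongrightarrow> 0) at_top"
proof -
  have lim: "((\<lambda>r. ln ((cmod (of_real r - u))\<^sup>2) - 2 * ln r) \<longlongrightarrow> 0) at_top" if u: "norm u = 1" for u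
    unfolding norm_diff_of_real_sq [OF u] by real_asymp
  have "((\<lambda>r. \<Sum>j\<in>A. \<Sum>k\<in>A. ln ((cmod (of_real r - w j * cnj (w k)))\<^sup>2) - 2 * ln r)
      \<longlongrightarrow> (\<Sum>j\<in>A. \<Sum>k\<in>A. 0)) at_top"
    using w by (intro tendsto_sum lim) (auto simp: norm_mult)
  then show ?thesis
    by (simp add: log_energy_def sum_subtractf power2_eq_square mult_ac)
qed

lemma le_of_DERIV_nonneg_tendsto_0:
  fixes f f' :: "real \<Rightarrow> real"
  assumes der: "\<And>x. x > a \<Longrightarrow> (f has_real_derivative f' x) (at x)"
    and nonneg: "\<And>x. x > a \<Longrightarrow> f' x \<ge> 0"
    and lim: "(f \<longlongrightarrow> 0) at_top" and x: "x > a"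
  shows "f x \<le> 0"
proof -
  have "f x \<le> f y" if "y \<ge> x" for y
    using that x der nonneg by (intro DERIV_nonneg_imp_nondecreasing [of x y f]) (auto intro: less_le_trans)
  then have "eventually (\<lambda>y. f x \<le> f y) at_top"
    unfolding eventually_at_top_linorder by blast
  with lim show ?thesis
    by (intro tendsto_lowerbound [of f 0 at_top]) auto
qed

lemma fejer_energy_nonneg: "fejer_energy A w r \<ge> 0"
  unfolding fejer_energy_def by (intro sum_nonneg) auto

lemma fejer_energy_pos:
  fixes w :: "'a \<Rightarrow> complex"
  assumes "finite A" and w: "\<And>j. j \<in> A \<Longrightarrow> norm (w j) = 1" and r: "r > 1"
    and jk: "j \<in> A" "k \<in> A" "j \<noteq> k" "(\<Sum>i<card A. (w j * cnj (w k)) ^ i) \<noteq> 0"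
  shows "fejer_energy A w r > 0"
proof -
  have "norm (w j * cnj (w k)) = 1"
    using w jk by (simp add: norm_mult)
  note norm_diff_of_real_pos [OF this r]
  with jk have "(\<Sum>k\<in>A - {j}. (cmod (\<Sum>i<card A. (w j * cnj (w k)) ^ i))\<^sup>2
      / (cmod (of_real r - w j * cnj (w k)))\<^sup>2) > 0"
    using \<open>finite A\<close> by (intro sum_pos2 [where i = k]) auto
  then show ?thesis
    unfolding fejer_energy_def using \<open>finite A\<close> jk
    by (intro sum_pos2 [OF \<open>finite A\<close> jk(1)] sum_nonneg) auto
qed

lemma log_energy_le:
  fixes w :: "'a \<Rightarrow> complex"
  assumes "finite A" and w: "\<And>j. j \<in> A \<Longrightarrow> norm (w j) = 1" and n: "card A = n" "n > 0" and r: "r > 1"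
  shows "log_energy A w r \<le> log_energy {..<n} (root_unity n) r" (is ?le)
    and "j \<in> A \<Longrightarrow> k \<in> A \<Longrightarrow> j \<noteq> k \<Longrightarrow> (\<Sum>i<n. (w j * cnj (w k)) ^ i) \<noteq> 0 \<Longrightarrow>
      log_energy A w r < log_energy {..<n} (root_unity n) r"
proof -
  let ?f = "\<lambda>r. log_energy A w r - log_energy {..<n} (root_unity n) r"
  let ?f' = "\<lambda>r. (r\<^sup>2 - 1) / r * (energy A w r - energy_min n r)"
  have der: "(?f has_real_derivative ?f' r) (at r)" if "r > 1" for r
  proof -
    have "(?f has_real_derivative ((real n)\<^sup>2 / r + (r\<^sup>2 - 1) / r * energy A w r)
        - ((real n)\<^sup>2 / r + (r\<^sup>2 - 1) / r * energy {..<n} (root_unity n) r)) (at r)"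
      using DERIV_log_energy [of A w r] DERIV_log_energy [of "{..<n}" "root_unity n" r] w n that
      by (intro DERIV_diff) auto
    then show ?thesis
      using energy_root_unity [of n r] n that by (simp add: right_diff_distrib)
  qed
  have ge: "energy A w r - energy_min n r \<ge> fejer_energy A w r / fejer_weight n r" if "r > 1" for r
    using energy_ge [of A w, OF \<open>finite A\<close> w n that] by simp
  have weight: "fejer_weight n r > 0" if "r > 1" for r
    using n that by (intro fejer_weight_pos) auto
  have fac: "(r\<^sup>2 - 1) / r > 0" if "r > 1" for r :: real
    using that by (simp add: one_less_power)
  have nonneg: "?f' r \<ge> 0" if "r > 1" for r
  proof -
    have "fejer_energy A w r / fejer_weight n r \<ge> 0"
      using fejer_energy_nonneg [of A w r] weight [OF that] by (simp add: less_imp_le)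
    then show ?thesis
      using ge [OF that] fac [OF that] by (intro mult_nonneg_nonneg) auto
  qed
  have lim: "(?f \<longlongrightarrow> 0) at_top"
    using tendsto_diff [OF log_energy_tendsto [of A w] log_energy_tendsto [of "{..<n}" "root_unity n"]] w n
    by simp
  have le: "?f r \<le> 0" if "r > 1" for r
    using le_of_DERIV_nonneg_tendsto_0 [of 1 ?f ?f' r] der nonneg lim that by blast
  then show ?le
    using r by force
  assume jk: "j \<in> A" "k \<in> A" "j \<noteq> k" "(\<Sum>i<n. (w j * cnj (w k)) ^ i) \<noteq> 0"
  have pos: "?f' s > 0" if "s > 1" for s
  proof -
    have "fejer_energy A w s > 0"
      using fejer_energy_pos [of A w s j k, OF \<open>finite A\<close> w that jk(1-3)] jk(4) n by simp
    then have "fejer_energy A w s / fejer_weight n s > 0"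
      using weight [OF that] by simp
    then show ?thesis
      using ge [OF that] fac [OF that] by (intro mult_pos_pos) auto
  qed
  \<comment> \<open>Strict growth just to the right of \<open>r\<close> suffices, since the value at \<open>r + 1\<close> is at most 0.\<close>
  have "?f r < ?f (r + 1)"
  proof (rule DERIV_pos_imp_increasing [of r "r + 1" ?f])
    fix x assume "r \<le> x" "x \<le> r + 1"
    then show "\<exists>y. (?f has_real_derivative y) (at x) \<and> 0 < y"
      using der [of x] pos [of x] r by force
  qed simp
  also have "\<dots> \<le> 0"
    using le [of "r + 1"] r by simp
  finally show "log_energy A w r < log_energy {..<n} (root_unity n) r"
    by simp
qed

lemma prod_roots_unity:
  fixes x :: complex
  assumes n: "n > 0"
  shows "(\<Prod>\<zeta> | \<zeta> ^ n = 1. x - \<zeta>) = x ^ n - 1"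
proof -
  define p :: "complex poly" where "p = monom 1 n - 1"
  have poly_p: "poly p y = y ^ n - 1" for y
    by (simp add: p_def poly_monom)
  have "rsquarefree p"
    unfolding rsquarefree_roots
  proof (intro allI notI)
    fix a assume a: "poly p a = 0 \<and> poly (pderiv p) a = 0"
    then have "a ^ n = 1" "of_nat n * a ^ (n - 1) = 0"
      by (auto simp: poly_p p_def pderiv_diff pderiv_monom poly_monom)
    then show False
      using n by (auto simp: power_0_left)
  qed
  moreover have "lead_coeff p = 1"
  proof -
    have "degree p = n"
      unfolding p_def diff_conv_add_uminus using n
      by (subst degree_add_eq_left) (auto simp: degree_monom_eq)
    then show ?thesis
      using n by (simp add: p_def)
  qed
  ultimately have "(\<Prod>\<zeta> | poly p \<zeta> = 0. [:- \<zeta>, 1:]) = p"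
    using complex_poly_decompose_rsquarefree [of p] by simp
  from arg_cong [OF this, of "\<lambda>p. poly p x"] show ?thesis
    by (simp add: poly_prod poly_p)
qed

lemma prod_root_unity_pairs:
  assumes n: "n > 0" and r: "r \<ge> 1"
  shows "(\<Prod>j<n. \<Prod>k<n. cmod (of_real r - root_unity n j * cnj (root_unity n k))) = (r ^ n - 1) ^ n"
proof -
  have "(\<Prod>k<n. cmod (of_real r - root_unity n j * cnj (root_unity n k))) = r ^ n - 1" if "j < n" for j
  proof -
    have one: "root_unity n j ^ n = 1"
      using bij_betw_root_unity [OF n] that by (auto simp: bij_betw_def)
    have "cmod (of_real r - root_unity n j * cnj \<zeta>) = cmod (of_real r * cnj (root_unity n j) - cnj \<zeta>)" for \<zeta>
    proof -
      have "of_real r - root_unity n j * cnj \<zeta>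
          = root_unity n j * (of_real r * cnj (root_unity n j) - cnj \<zeta>)"
        using mult_cnj_of_norm_1 [of "root_unity n j"] by (simp add: algebra_simps)
      then show ?thesis
        by (simp add: norm_mult)
    qed
    also have "\<dots> \<zeta> = cmod (of_real r * root_unity n j - \<zeta>)" for \<zeta>
      by (metis complex_cnj_complex_of_real complex_cnj_diff complex_cnj_mult complex_mod_cnj)
    finally have "(\<Prod>k<n. cmod (of_real r - root_unity n j * cnj (root_unity n k)))
        = (\<Prod>k<n. cmod (of_real r * root_unity n j - root_unity n k))"
      by simp
    also have "\<dots> = (\<Prod>\<zeta> | \<zeta> ^ n = 1. cmod (of_real r * root_unity n j - \<zeta>))"
      by (rule prod.reindex_bij_betw [OF bij_betw_root_unity [OF n]])
    also have "\<dots> = cmod (of_real (r ^ n) - 1)"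
      unfolding prod_norm prod_roots_unity [OF n] by (simp add: power_mult_distrib one)
    also have "\<dots> = \<bar>r ^ n - 1\<bar>"
      by (metis norm_of_real of_real_1 of_real_diff)
    finally show ?thesis
      using r by (simp add: one_le_power)
  qed
  then show ?thesis
    by simp
qed

lemma exp_log_energy:
  fixes w :: "'a \<Rightarrow> complex"
  assumes "finite A" and w: "\<And>j. j \<in> A \<Longrightarrow> norm (w j) = 1" and r: "r > 1"
  shows "exp (log_energy A w r) = (\<Prod>j\<in>A. \<Prod>k\<in>A. cmod (of_real r - w j * cnj (w k)))\<^sup>2"
proof -
  have "exp (ln ((cmod (of_real r - w j * cnj (w k)))\<^sup>2)) = (cmod (of_real r - w j * cnj (w k)))\<^sup>2"
    if "j \<in> A" "k \<in> A" for j k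
    using norm_diff_of_real_pos [of "w j * cnj (w k)" r] w that r by (simp add: norm_mult)
  then show ?thesis
    unfolding log_energy_def using \<open>finite A\<close> by (simp add: exp_sum prod_power_distrib)
qed

text \<open>
  The extremal problem on the circle, with its diagonal factors \<open>r - 1\<close>, and a strict form
  whenever some pair of distinct indices has a nonvanishing geometric sum.
\<close>

theorem circle_pair_product_le:
  fixes w :: "'a \<Rightarrow> complex"
  assumes "finite A" and w: "\<And>j. j \<in> A \<Longrightarrow> norm (w j) = 1" and n: "card A = n" "n > 0" and r: "r > 1"
  shows "(\<Prod>j\<in>A. \<Prod>k\<in>A. cmod (of_real r - w j * cnj (w k))) \<le> (r ^ n - 1) ^ n" (is "?P \<le> ?B")
    and "j \<in> A \<Longrightarrow> k \<in> A \<Longrightarrow> j \<noteq> k \<Longrightarrow> (\<Sum>i<n. (w j * cnj (w k)) ^ i) \<noteq> 0 \<Longrightarrow>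
      (\<Prod>j\<in>A. \<Prod>k\<in>A. cmod (of_real r - w j * cnj (w k))) < (r ^ n - 1) ^ n"
proof -
  have P: "?P\<^sup>2 = exp (log_energy A w r)"
    using exp_log_energy [OF \<open>finite A\<close> w r] by simp
  have B: "?B\<^sup>2 = exp (log_energy {..<n} (root_unity n) r)"
    using exp_log_energy [of "{..<n}" "root_unity n" r] prod_root_unity_pairs [of n r] n r by simp
  have nn: "?B \<ge> 0"
    using r by (simp add: one_le_power)
  show "?P \<le> ?B"
    using log_energy_le(1) [of A w n r, OF assms] nn P B
    by (intro power2_le_imp_le [of ?P ?B]) (simp_all only: exp_le_cancel_iff)
  assume "j \<in> A" "k \<in> A" "j \<noteq> k" "(\<Sum>i<n. (w j * cnj (w k)) ^ i) \<noteq> 0"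
  from log_energy_le(2) [of A w n r, OF assms this] show "?P < ?B"
    using nn P B by (intro power2_less_imp_less [of ?P ?B]) (simp_all only: exp_less_cancel_iff)
qed


section \<open>Reduction to the circle\<close>

text \<open>
  The product over ordered pairs of distinct indices.
\<close>

definition offdiag_prod :: "'a set \<Rightarrow> ('a \<Rightarrow> complex) \<Rightarrow> real" where
  "offdiag_prod A z = (\<Prod>j\<in>A. \<Prod>k\<in>A - {j}. cmod (1 - cnj (z j) * z k))"

lemma offdiag_prod_nonneg: "offdiag_prod A z \<ge> 0"
  unfolding offdiag_prod_def by (intro prod_nonneg) auto

lemma norm_one_minus_cnj_commute: "cmod (1 - cnj a * b) = cmod (1 - cnj b * a)"
  by (metis complex_cnj_cnj complex_cnj_diff complex_cnj_mult complex_cnj_one complex_mod_cnj mult.commute)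

lemma offdiag_prod_remove:
  assumes "finite A" "i \<in> A"
  shows "offdiag_prod A z
    = offdiag_prod (A - {i}) z * (cmod (\<Prod>k\<in>A - {i}. 1 - cnj (z k) * z i))\<^sup>2"
proof -
  let ?N = "\<lambda>j k. cmod (1 - cnj (z j) * z k)"
  have "(\<Prod>k\<in>A - {j}. ?N j k) = ?N j i * (\<Prod>k\<in>A - {i} - {j}. ?N j k)" if "j \<in> A - {i}" for j
  proof -
    have "A - {j} - {i} = A - {i} - {j}"
      by auto
    then show ?thesis
      using assms that prod.remove [of "A - {j}" i "?N j"] by auto
  qed
  then have "offdiag_prod A z = (\<Prod>k\<in>A - {i}. ?N i k) *
      ((\<Prod>j\<in>A - {i}. ?N j i) * offdiag_prod (A - {i}) z)"
    unfolding offdiag_prod_def using assms by (simp add: prod.remove prod.distrib)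
  also have "(\<Prod>k\<in>A - {i}. ?N i k) = (\<Prod>k\<in>A - {i}. ?N k i)"
    by (intro prod.cong refl norm_one_minus_cnj_commute)
  finally show ?thesis
    by (simp add: prod_norm power2_eq_square mult_ac)
qed

lemma entire_strict_maximum_modulus:
  fixes f :: "complex \<Rightarrow> complex"
  assumes f: "f holomorphic_on UNIV" and nonconst: "\<not> f constant_on UNIV" and x: "norm x < \<rho>"
  shows "\<exists>y. norm y = \<rho> \<and> norm (f x) < norm (f y)"
proof -
  have "\<rho> > 0"
    using x norm_ge_zero [of x] by linarith
  have cont: "continuous_on X f" for X
    using f holomorphic_on_imp_continuous_on continuous_on_subset by blast
  have "sphere (0::complex) \<rho> \<noteq> {}"
    using \<open>\<rho> > 0\<close> by simp
  then obtain y where y: "y \<in> sphere 0 \<rho>" and ymax: "\<And>v. v \<in> sphere 0 \<rho> \<Longrightarrow> norm (f v) \<le> norm (f y)"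
    using continuous_attains_sup [of "sphere 0 \<rho>" "\<lambda>v. norm (f v)"] continuous_on_norm [OF cont]
    by auto
  have ball: "norm (f v) \<le> norm (f y)" if "v \<in> ball 0 \<rho>" for v
  proof (rule maximum_modulus_frontier [of f "ball 0 \<rho>"])
    show "f holomorphic_on interior (ball 0 \<rho>)"
      using f holomorphic_on_subset by blast
  qed (use cont ymax that \<open>\<rho> > 0\<close> in \<open>auto simp: frontier_ball\<close>)
  have "norm (f x) < norm (f y)"
  proof (rule ccontr)
    assume "\<not> norm (f x) < norm (f y)"
    with ball have "\<And>v. v \<in> ball 0 \<rho> \<Longrightarrow> norm (f v) \<le> norm (f x)"
      by fastforce
    then have "f constant_on UNIV"
      using f x by (intro maximum_modulus_principle [of f UNIV "ball 0 \<rho>" x]) auto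
    with nonconst show False ..
  qed
  with y show ?thesis by auto
qed

text \<open>
  As a function of the \<open>i\<close>-th point, the product is a constant times the squared modulus of a
  polynomial, which is nonconstant because it is 1 at 0 and has the root \<open>1 / cnj (z m)\<close>.
\<close>

lemma offdiag_prod_push_to_circle:
  fixes z :: "'a \<Rightarrow> complex"
  assumes "finite A" "i \<in> A" and i: "norm (z i) < \<rho>" and m: "m \<in> A" "m \<noteq> i" "z m \<noteq> 0"
    and nz: "offdiag_prod A z \<noteq> 0"
  shows "\<exists>y. norm y = \<rho> \<and> offdiag_prod A z < offdiag_prod A (z(i := y))"
proof -
  let ?f = "\<lambda>x. \<Prod>k\<in>A - {i}. 1 - cnj (z k) * x"
  have "\<not> ?f constant_on UNIV"
  proof
    assume "?f constant_on UNIV"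
    then have "?f 0 = ?f (1 / cnj (z m))"
      unfolding constant_on_def by (metis UNIV_I)
    moreover have "?f (1 / cnj (z m)) = 0"
      using \<open>finite A\<close> m by (auto simp: prod_zero_iff)
    ultimately show False
      by simp
  qed
  moreover have "?f holomorphic_on UNIV"
    by (intro holomorphic_intros)
  ultimately obtain y where y: "norm y = \<rho>" "norm (?f (z i)) < norm (?f y)"
    using entire_strict_maximum_modulus [of ?f "z i" \<rho>] i by blast
  have "offdiag_prod (A - {i}) (z(i := y)) = offdiag_prod (A - {i}) z"
    unfolding offdiag_prod_def by (intro prod.cong refl) auto
  moreover have "(\<Prod>k\<in>A - {i}. 1 - cnj ((z(i := y)) k) * (z(i := y)) i) = ?f y"
    by (intro prod.cong refl) auto
  ultimately have "offdiag_prod A (z(i := y)) = offdiag_prod (A - {i}) z * (norm (?f y))\<^sup>2"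
    using offdiag_prod_remove [OF \<open>finite A\<close> \<open>i \<in> A\<close>] by simp
  moreover have eq: "offdiag_prod A z = offdiag_prod (A - {i}) z * (norm (?f (z i)))\<^sup>2"
    using offdiag_prod_remove [OF \<open>finite A\<close> \<open>i \<in> A\<close>] .
  moreover have "offdiag_prod (A - {i}) z > 0"
    using nz eq offdiag_prod_nonneg [of "A - {i}" z] by force
  moreover have "(norm (?f (z i)))\<^sup>2 < (norm (?f y))\<^sup>2"
    using y by (intro power_strict_mono) auto
  ultimately show ?thesis
    using y by auto
qed

lemma norm_one_minus_circle:
  assumes a: "norm a = 1" and b: "norm b = 1"
  shows "cmod (1 - cnj (of_real \<rho> * a) * (of_real \<rho> * b)) = cmod (of_real (\<rho>\<^sup>2) - a * cnj b)"
proof -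
  have "of_real (\<rho>\<^sup>2) - a * cnj b = - (a * cnj b) * (1 - cnj (of_real \<rho> * a) * (of_real \<rho> * b))"
  proof -
    have "a * cnj b * (cnj a * b) = (a * cnj a) * (b * cnj b)"
      by (simp only: mult_ac)
    then have "a * cnj b * (cnj a * b) = 1"
      using mult_cnj_of_norm_1 [OF a] mult_cnj_of_norm_1 [OF b] by simp
    then show ?thesis
      by (simp add: algebra_simps power2_eq_square)
  qed
  then show ?thesis
    using a b by (simp add: norm_mult)
qed

lemma offdiag_prod_circle:
  fixes w :: "'a \<Rightarrow> complex"
  assumes "finite A" and w: "\<And>j. j \<in> A \<Longrightarrow> norm (w j) = 1" and z: "\<And>j. j \<in> A \<Longrightarrow> z j = of_real \<rho> * w j"
    and \<rho>: "\<rho> > 1"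
  shows "(\<Prod>j\<in>A. \<Prod>k\<in>A. cmod (of_real (\<rho>\<^sup>2) - w j * cnj (w k)))
    = offdiag_prod A z * (\<rho>\<^sup>2 - 1) ^ card A"
proof -
  have "(\<Prod>k\<in>A. cmod (of_real (\<rho>\<^sup>2) - w j * cnj (w k)))
      = (\<rho>\<^sup>2 - 1) * (\<Prod>k\<in>A - {j}. cmod (1 - cnj (z j) * z k))" if "j \<in> A" for j
  proof -
    have "cmod (of_real (\<rho>\<^sup>2) - w j * cnj (w j)) = cmod (of_real (\<rho>\<^sup>2 - 1))"
      using mult_cnj_of_norm_1 [OF w [OF that]] by simp
    also have "\<dots> = \<rho>\<^sup>2 - 1"
      using \<rho> unfolding norm_of_real by (simp add: one_le_power)
    finally have "(\<Prod>k\<in>A. cmod (of_real (\<rho>\<^sup>2) - w j * cnj (w k)))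
        = (\<rho>\<^sup>2 - 1) * (\<Prod>k\<in>A - {j}. cmod (of_real (\<rho>\<^sup>2) - w j * cnj (w k)))"
      using \<open>finite A\<close> that by (simp add: prod.remove)
    also have "(\<Prod>k\<in>A - {j}. cmod (of_real (\<rho>\<^sup>2) - w j * cnj (w k)))
        = (\<Prod>k\<in>A - {j}. cmod (1 - cnj (z j) * z k))"
      using that z norm_one_minus_circle [OF w w] by (intro prod.cong refl) auto
    finally show ?thesis .
  qed
  then show ?thesis
    unfolding offdiag_prod_def by (simp add: prod.distrib)
qed

text \<open>
  The extremal value, written with quotients of natural powers.
\<close>

definition pair_bound :: "nat \<Rightarrow> real \<Rightarrow> real" where
  "pair_bound n \<rho> = ((\<rho>\<^sup>2) ^ n - 1) ^ n / (\<rho>\<^sup>2 - 1) ^ n"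

lemma pair_bound_gt_1:
  assumes "n \<ge> 2" "\<rho> > 1"
  shows "pair_bound n \<rho> > 1"
proof -
  have "\<rho>\<^sup>2 > 1"
    using assms by (simp add: one_less_power)
  moreover from this have "(\<rho>\<^sup>2) ^ 1 < (\<rho>\<^sup>2) ^ n"
    using assms by (intro power_strict_increasing) auto
  ultimately have "(\<rho>\<^sup>2 - 1) ^ n < ((\<rho>\<^sup>2) ^ n - 1) ^ n" "(\<rho>\<^sup>2 - 1) ^ n > 0"
    using assms by (auto intro!: power_strict_mono)
  then show ?thesis
    by (simp add: pair_bound_def)
qed

lemma offdiag_prod_circle_le:
  fixes z :: "'a \<Rightarrow> complex"
  assumes "finite A" and n: "card A = n" "n > 0" and \<rho>: "\<rho> > 1"
    and z: "\<And>j. j \<in> A \<Longrightarrow> norm (z j) = \<rho>"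
  shows "offdiag_prod A z \<le> pair_bound n \<rho>"
    and "j \<in> A \<Longrightarrow> k \<in> A \<Longrightarrow> j \<noteq> k \<Longrightarrow>
      (\<Sum>i<n. (z j / of_real \<rho> * cnj (z k / of_real \<rho>)) ^ i) \<noteq> 0 \<Longrightarrow>
      offdiag_prod A z < pair_bound n \<rho>"
proof -
  have r: "\<rho>\<^sup>2 > 1"
    using \<rho> by (simp add: one_less_power)
  let ?w = "\<lambda>j. z j / of_real \<rho>"
  have w: "norm (?w j) = 1" if "j \<in> A" for j
    using z [OF that] \<rho> by (simp add: norm_divide)
  have eq: "(\<Prod>j\<in>A. \<Prod>k\<in>A. cmod (of_real (\<rho>\<^sup>2) - ?w j * cnj (?w k)))
      = offdiag_prod A z * (\<rho>\<^sup>2 - 1) ^ n"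
    using offdiag_prod_circle [of A ?w z \<rho>] \<open>finite A\<close> w \<rho> n by simp
  show "offdiag_prod A z \<le> pair_bound n \<rho>"
    using circle_pair_product_le(1) [of A ?w, OF \<open>finite A\<close> w n r] r unfolding eq
    by (simp add: pair_bound_def le_divide_eq)
  assume "j \<in> A" "k \<in> A" "j \<noteq> k" "(\<Sum>i<n. (?w j * cnj (?w k)) ^ i) \<noteq> 0"
  from circle_pair_product_le(2) [of A ?w, OF \<open>finite A\<close> w n r this]
  show "offdiag_prod A z < pair_bound n \<rho>"
    unfolding eq using r by (simp add: pair_bound_def less_divide_eq)
qed

text \<open>
  By induction on the number of points that lie inside the circle.
\<close>

lemma offdiag_prod_le:
  fixes z :: "'a \<Rightarrow> complex"
  assumes "finite A" and n: "card A = n" "n \<ge> 2" and \<rho>: "\<rho> > 1"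
    and z: "\<And>j. j \<in> A \<Longrightarrow> norm (z j) \<le> \<rho>"
  shows "offdiag_prod A z \<le> pair_bound n \<rho> \<and>
    ((\<exists>j\<in>A. norm (z j) < \<rho>) \<longrightarrow> offdiag_prod A z < pair_bound n \<rho>)"
  using z
proof (induction "card {j\<in>A. norm (z j) < \<rho>}" arbitrary: z rule: less_induct)
  case less
  show ?case
  proof (cases "\<exists>i\<in>A. norm (z i) < \<rho>")
    case False
    then have "\<And>j. j \<in> A \<Longrightarrow> norm (z j) = \<rho>"
      using less.prems by force
    then show ?thesis
      using offdiag_prod_circle_le(1) [OF \<open>finite A\<close> n(1) _ \<rho>, of z] n False by auto
  next
    case True
    then obtain i where i: "i \<in> A" "norm (z i) < \<rho>"
      by blast
    consider "\<forall>m\<in>A - {i}. z m = 0" | "offdiag_prod A z = 0"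
      | m where "m \<in> A" "m \<noteq> i" "z m \<noteq> 0" "offdiag_prod A z \<noteq> 0"
      by blast
    then have "offdiag_prod A z < pair_bound n \<rho>"
    proof cases
      case 1
      have "offdiag_prod A z = 1"
        unfolding offdiag_prod_def using 1 by (intro prod.neutral ballI) (metis DiffD1 DiffD2 DiffI
            complex_cnj_zero diff_zero insertI1 insertE empty_iff mult_zero_left mult_zero_right norm_one)
      then show ?thesis
        using pair_bound_gt_1 [OF n(2) \<rho>] by simp
    next
      case 2
      then show ?thesis
        using pair_bound_gt_1 [OF n(2) \<rho>] by simp
    next
      case 3
      then obtain y where y: "norm y = \<rho>" "offdiag_prod A z < offdiag_prod A (z(i := y))"
        using offdiag_prod_push_to_circle [of A i z \<rho> m] \<open>finite A\<close> i by blast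
      have "{j\<in>A. norm ((z(i := y)) j) < \<rho>} \<subset> {j\<in>A. norm (z j) < \<rho>}"
        using i y by (auto split: if_splits)
      then have "card {j\<in>A. norm ((z(i := y)) j) < \<rho>} < card {j\<in>A. norm (z j) < \<rho>}"
        using \<open>finite A\<close> by (intro psubset_card_mono) auto
      then have "offdiag_prod A (z(i := y)) \<le> pair_bound n \<rho>"
        using less.hyps [of "z(i := y)"] less.prems y by auto
      with y show ?thesis by simp
    qed
    then show ?thesis by simp
  qed
qed

section \<open>Regular polygons and equality\<close>

lemma regular_ngon_vertices_iff:
  "regular_ngon_vertices n 0 \<rho> S \<longleftrightarrow>
    (\<exists>v. norm v = 1 \<and> S = (\<lambda>k. of_real \<rho> * (v * root_unity n k)) ` {..<n})" (is "?L \<longleftrightarrow> ?R")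
proof -
  have eq: "(\<lambda>k. 0 + of_real \<rho> * cis (\<theta> + 2 * pi * real k / real n))
      = (\<lambda>k. of_real \<rho> * (cis \<theta> * root_unity n k))" for \<theta>
    by (simp add: root_unity_def cis_mult)
  have "norm v = 1 \<Longrightarrow> \<exists>\<theta>. v = cis \<theta>" for v
    by (metis cis_Arg norm_zero sgn_div_norm inverse_1 scaleR_one zero_neq_one)
  then show ?thesis
    unfolding regular_ngon_vertices_def eq by (metis norm_cis)
qed

lemma offdiag_prod_regular_ngon:
  fixes z :: "'a \<Rightarrow> complex"
  assumes "finite A" and n: "card A = n" "n > 0" and \<rho>: "\<rho> > 1"
    and ngon: "regular_ngon_vertices n 0 \<rho> (z ` A)"
  shows "offdiag_prod A z = pair_bound n \<rho>"
proof -
  obtain v where v: "norm v = 1" and im: "z ` A = (\<lambda>k. of_real \<rho> * (v * root_unity n k)) ` {..<n}"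
    using ngon unfolding regular_ngon_vertices_iff by blast
  let ?g = "\<lambda>k. of_real \<rho> * (v * root_unity n k)"
  have "inj_on ?g {..<n}"
    using bij_betw_root_unity [OF n(2)] v \<rho> by (auto simp: bij_betw_def inj_on_def)
  then have bg: "bij_betw ?g {..<n} (z ` A)"
    using im by (simp add: bij_betw_def)
  then have "card (z ` A) = card A"
    using bij_betw_same_card n by fastforce
  then have bz: "bij_betw z A (z ` A)"
    using \<open>finite A\<close> by (simp add: eq_card_imp_inj_on bij_betw_def)
  \<comment> \<open>The points are distinct, being as many as the vertices, so \<open>h\<close> numbers them by vertices.\<close>
  define h where "h = inv_into {..<n} ?g \<circ> z"
  have h: "bij_betw h A {..<n}"
    unfolding h_def using bz bg by (intro bij_betw_trans [OF bz] bij_betw_inv_into)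
  have zh: "z j = of_real \<rho> * (v * root_unity n (h j))" if "j \<in> A" for j
  proof -
    have "z j \<in> ?g ` {..<n}"
      using im that by blast
    then show ?thesis
      unfolding h_def o_def by (rule f_inv_into_f [symmetric])
  qed
  have "offdiag_prod A z * (\<rho>\<^sup>2 - 1) ^ n = (\<Prod>j\<in>A. \<Prod>k\<in>A.
      cmod (of_real (\<rho>\<^sup>2) - v * root_unity n (h j) * cnj (v * root_unity n (h k))))"
    using offdiag_prod_circle [of A "\<lambda>j. v * root_unity n (h j)" z \<rho>] \<open>finite A\<close> zh v \<rho> n
    by (simp add: norm_mult)
  also have "\<dots> = (\<Prod>j\<in>A. \<Prod>k\<in>A. cmod (of_real (\<rho>\<^sup>2) - root_unity n (h j) * cnj (root_unity n (h k))))"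
  proof -
    have "v * a * cnj (v * b) = a * cnj b" for a b
    proof -
      have "v * a * cnj (v * b) = (v * cnj v) * (a * cnj b)"
        by (simp add: mult_ac)
      then show ?thesis
        using mult_cnj_of_norm_1 [OF v] by simp
    qed
    then show ?thesis by (simp only:)
  qed
  also have "\<dots> = (\<Prod>j<n. \<Prod>k<n. cmod (of_real (\<rho>\<^sup>2) - root_unity n j * cnj (root_unity n k)))"
    unfolding prod.reindex_bij_betw [OF h, of "\<lambda>k. cmod (of_real (\<rho>\<^sup>2) - root_unity n _ * cnj (root_unity n k))"]
    by (rule prod.reindex_bij_betw [OF h])
  also have "\<dots> = ((\<rho>\<^sup>2) ^ n - 1) ^ n"
    using n \<rho> by (intro prod_root_unity_pairs) (auto simp: one_le_power)
  finally show ?thesis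
    using one_less_power [OF \<rho>, of 2] by (simp add: pair_bound_def eq_divide_eq)
qed

text \<open>
  The vanishing sums make the quotients by one fixed point pairwise distinct \<open>n\<close>-th roots of
  unity, and there are only \<open>n\<close> of those.
\<close>

lemma regular_ngon_of_geometric_sums:
  fixes w :: "'a \<Rightarrow> complex"
  assumes "finite A" and n: "card A = n" "n > 0" and w: "\<And>j. j \<in> A \<Longrightarrow> norm (w j) = 1"
    and z: "\<And>j. j \<in> A \<Longrightarrow> z j = of_real \<rho> * w j"
    and sums: "\<And>j k. j \<in> A \<Longrightarrow> k \<in> A \<Longrightarrow> j \<noteq> k \<Longrightarrow> (\<Sum>i<n. (w j * cnj (w k)) ^ i) = 0"
  shows "regular_ngon_vertices n 0 \<rho> (z ` A)"
proof -
  obtain a where a: "a \<in> A"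
    using n by fastforce
  let ?u = "\<lambda>j. w j * cnj (w a)"
  have wu: "w a * ?u j = w j" for j
    using mult_cnj_of_norm_1 [OF w [OF a]] by (simp add: mult_ac)
  have roots: "?u j ^ n = 1" if "j \<in> A" for j
  proof (cases "j = a")
    case True
    then show ?thesis
      using mult_cnj_of_norm_1 [OF w [OF a]] by simp
  next
    case False
    then show ?thesis
      using power_diff_1_eq [of "?u j" n] sums [OF that a] by simp
  qed
  have inj: "inj_on ?u A"
  proof (rule inj_onI)
    fix j k assume jk: "j \<in> A" "k \<in> A" "?u j = ?u k"
    then have "w j * cnj (w k) = 1"
      using wu [of j] wu [of k] mult_cnj_of_norm_1 [OF w] by metis
    then show "j = k"
      using sums [OF jk(1,2)] n by fastforce
  qed
  have roots_card: "card {\<zeta>::complex. \<zeta> ^ n = 1} = n" "finite {\<zeta>::complex. \<zeta> ^ n = 1}"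
    using n by (simp_all add: card_roots_unity_eq finite_roots_unity)
  have "?u ` A = {\<zeta>. \<zeta> ^ n = 1}"
    using roots roots_card card_image [OF inj] n by (intro card_subset_eq) auto
  also have "\<dots> = root_unity n ` {..<n}"
    using bij_betw_root_unity [OF n(2)] by (simp add: bij_betw_def)
  finally have im: "?u ` A = root_unity n ` {..<n}" .
  have "z ` A = (\<lambda>x. of_real \<rho> * (w a * x)) ` (?u ` A)"
    unfolding image_image wu using z by (intro image_cong refl) auto
  also have "\<dots> = (\<lambda>k. of_real \<rho> * (w a * root_unity n k)) ` {..<n}"
    unfolding im image_image ..
  finally show ?thesis
    unfolding regular_ngon_vertices_iff using w [OF a] by blast
qed

theorem theorem2:
  fixes n :: nat and \<rho> :: real and z :: "nat \<Rightarrow> complex"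
  assumes "n \<ge> 1"
    and "\<rho> > 1"
    and "\<And>j. j \<in> {1..n} \<Longrightarrow> norm (z j) \<le> \<rho>"
  defines "P \<equiv> (\<Prod>(j, k) \<in> {(j, k). j \<in> {1..n} \<and> k \<in> {1..n} \<and> j \<noteq> k}. norm (1 - cnj (z j) * z k))"
    and "B \<equiv> (\<rho> ^ (2 * n) - 1) ^ n * (\<rho>\<^sup>2 - 1) powi (- int n)"
  shows "P \<le> B \<and>
    (regular_ngon_vertices n 0 \<rho> (z ` {1..n}) \<longrightarrow> P = B) \<and>
    (n \<ge> 2 \<longrightarrow> P = B \<longrightarrow> regular_ngon_vertices n 0 \<rho> (z ` {1..n}))"
proof -
  have "{(j, k). j \<in> {1..n} \<and> k \<in> {1..n} \<and> j \<noteq> k} = (SIGMA j:{1..n}. {1..n} - {j})"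
    by auto
  then have P: "P = offdiag_prod {1..n} z"
    unfolding P_def offdiag_prod_def by (simp add: prod.Sigma)
  have B: "B = pair_bound n \<rho>"
    unfolding B_def pair_bound_def
    by (simp add: power_int_minus field_simps flip: power_mult)
  have "offdiag_prod {1..n} z \<le> pair_bound n \<rho>"
  proof (cases "n = 1")
    case True
    then show ?thesis
      using one_less_power [OF \<open>\<rho> > 1\<close>, of 2] by (simp add: offdiag_prod_def pair_bound_def)
  next
    case False
    then show ?thesis
      using offdiag_prod_le [of "{1..n}" n \<rho> z] assms(1-3) by simp
  qed
  moreover have "offdiag_prod {1..n} z = pair_bound n \<rho>" if "regular_ngon_vertices n 0 \<rho> (z ` {1..n})"
    using offdiag_prod_regular_ngon [OF _ _ _ \<open>\<rho> > 1\<close> that] \<open>n \<ge> 1\<close> by simp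
  moreover have "regular_ngon_vertices n 0 \<rho> (z ` {1..n})"
    if "n \<ge> 2" and eq: "offdiag_prod {1..n} z = pair_bound n \<rho>"
  proof -
    have on_circle: "norm (z j) = \<rho>" if "j \<in> {1..n}" for j
      using offdiag_prod_le [of "{1..n}" n \<rho> z] assms(2,3) \<open>n \<ge> 2\<close> eq that by force
    show ?thesis
    proof (rule regular_ngon_of_geometric_sums)
      fix j k assume "j \<in> {1..n}" "k \<in> {1..n}" "j \<noteq> k"
      then show "(\<Sum>i<n. (z j / of_real \<rho> * cnj (z k / of_real \<rho>)) ^ i) = 0"
        using offdiag_prod_circle_le(2) [of "{1..n}" n \<rho> z j k] on_circle eq \<open>\<rho> > 1\<close> \<open>n \<ge> 2\<close> by force
    qed (use on_circle \<open>\<rho> > 1\<close> \<open>n \<ge> 2\<close> in \<open>auto simp: norm_divide\<close>)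
  qed
  ultimately show ?thesis
    unfolding P B by blast
qed

end
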